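(* Let $N\ge 1$, $T\ge 1$ and $0\le S\le T-1$ be integers. The matrix $P^S_{S\mapsto S+1}$ with rows indexed by $\Omega(N,T,S)$ and columns indexed by $\Omega(N,T,S+1)$ (defined in the context) is stochastic, i.e. its entries are nonnegative and $\sum_{Y\in\Omega(N,T,S+1)}P^S_{S\mapsto S+1}(X,Y)=1$ for every $X\in\Omega(N,T,S)$. Moreover it maps the uniform measure to the uniform measure: for every $Y\in\Omega(N,T,S+1)$, $$\mu(N,T,S+1)(Y)=\sum_{X\in\Omega(N,T,S)}P^S_{S\mapsto S+1}(X,Y)\,\mu(N,T,S)(X).$$
   Context: Fix integers $N\ge1$, $T\ge1$. For an integer $0\le S\le T$, $\Omega(N,T,S)$ is the set of families of $N$ non-intersecting lattice paths $\tau_1,\dots,\tau_N:\{0,1,\dots,T\}\to\mathbb Z$ with $\tau_i(0)=i-1$, $\tau_i(T)=S+i-1$, $\tau_i(t+1)-\tau_i(t)\in\{0,1\}$ and $\tau_1(t)<\dots<\tau_N(t)$ for all $t$. Such a family is identified with the sequence $X=(X(0),X(1),\dots,X(T))$, $X(t)=(\tau_1(t),\dots,\tau_N(t))$. $\mu(N,T,S)$ is the uniform probability measure on $\Omega(N,T,S)$. For $0\le S,t\le T$ put $$\mathfrak X^{S,t}=\{x\in\mathbb Z:\max(0,t+S-T)\le x\le\min(t+N-1,S+N-1)\},$$ $$\mathcal X^{S,t}=\{(x_1,\dots,x_N)\in(\mathfrak X^{S,t})^N: x_1<\dots<x_N\};$$ then $X(t)\in\mathcal X^{S,t}$ for $X\in\Omega(N,T,S)$.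 $(a)_k=a(a+1)\cdots(a+k-1)$. Matrix $P^{S,t}_{t+}$ ($0\le t\le T-1$), of size $|\mathcal X^{S,t}|\times|\mathcal X^{S,t+1}|$: $$P^{S,t}_{t+}(X,Y)=\frac{\prod_{i<j}(y_j-y_i)\prod_{i:y_i=x_i+1}(N+S-x_i-1)\prod_{i:y_i=x_i}(x_i+T-t-S)}{(T-t)_N\prod_{i<j}(x_j-x_i)}$$ if $y_i-x_i\in\{0,1\}$ for all $i$, and $0$ otherwise. Matrix $P^{S,t}_{S-}$ ($1\le S\le T$), of size $|\mathcal X^{S,t}|\times|\mathcal X^{S-1,t}|$: $$P^{S,t}_{S-}(X,Y)=\frac{\prod_{i<j}(y_j-y_i)\prod_{i:y_i=x_i-1}x_i\prod_{i:y_i=x_i}(S+N-1-x_i)}{(S)_N\prod_{i<j}(x_j-x_i)}$$ if $y_i-x_i\in\{-1,0\}$ for all $i$, and $0$ otherwise. For $0\le S\le T-1$, $X\in\Omega(N,T,S)$, $Y\in\Omega(N,T,S+1)$ define $$P^S_{S\mapsto S+1}(X,Y)=\prod_{t=0}^{T-1}\frac{P^{S+1,t}_{t+}(Y(t),Y(t+1))\,P^{S+1,t+1}_{S-}(Y(t+1),X(t+1))}{(P^{S+1,t}_{t+}P^{S+1,t+1}_{S-})(Y(t),X(t+1))}$$ if $\prod_{t=0}^{T-1}(P^{S+1,t}_{t+}P^{S+1,t+1}_{S-})(Y(t),X(t+1))>0$, and $P^S_{S\mapsto S+1}(X,Y)=0$ otherwise. (Juxtaposition of matrices is the matrix product.)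 *)

theory Defs
  imports "HOL-Probability.Probability"
begin

text \<open>
  A point configuration \<open>(x\<^sub>1, \<dots>, x\<^sub>N)\<close> is an extensional function on \<open>{1..N}\<close>, and a family of
  paths is an extensional function on \<open>{0..T}\<close> with configurations as values: for
  \<open>X \<in> paths N T S\<close>, the value \<open>X t i\<close> is \<open>\<tau>\<^sub>i(t)\<close>. Extensionality makes each such object
  a unique element of its type, so that sums and uniform measures count it exactly once.
\<close>

definition paths :: "nat \<Rightarrow> nat \<Rightarrow> nat \<Rightarrow> (nat \<Rightarrow> nat \<Rightarrow> int) set" where
  "paths N T S = {X \<in> {0..T} \<rightarrow>\<^sub>E ({1..N} \<rightarrow>\<^sub>E UNIV).
     (\<forall>i\<in>{1..N}. X 0 i = int i - 1) \<and>
     (\<forall>i\<in>{1..N}. X T i = int S + int i - 1) \<and>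
     (\<forall>t<T. \<forall>i\<in>{1..N}. X (t + 1) i - X t i \<in> {0, 1}) \<and>
     (\<forall>t\<le>T. strict_mono_on {1..N} (X t))}"

definition path_measure :: "nat \<Rightarrow> nat \<Rightarrow> nat \<Rightarrow> (nat \<Rightarrow> nat \<Rightarrow> int) pmf" where
  "path_measure N T S = pmf_of_set (paths N T S)"

definition points :: "nat \<Rightarrow> nat \<Rightarrow> nat \<Rightarrow> nat \<Rightarrow> int set" where
  "points N T S t =
     {x. max 0 (int t + int S - int T) \<le> x \<and> x \<le> min (int t + int N - 1) (int S + int N - 1)}"

definition configs :: "nat \<Rightarrow> nat \<Rightarrow> nat \<Rightarrow> nat \<Rightarrow> (nat \<Rightarrow> int) set" where
  "configs N T S t = {x \<in> {1..N} \<rightarrow>\<^sub>E points N T S t. strict_mono_on {1..N} x}"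

definition vandermonde :: "nat \<Rightarrow> (nat \<Rightarrow> int) \<Rightarrow> real" where
  "vandermonde N x = (\<Prod>i\<in>{1..N}. \<Prod>j\<in>{i<..N}. real_of_int (x j - x i))"

text \<open>
  \<open>P_tplus N T S t\<close> has rows \<open>configs N T S t\<close> and columns \<open>configs N T S (t + 1)\<close>, where
  \<open>t < T\<close>; \<open>P_Sminus N T S t\<close> has rows \<open>configs N T S t\<close> and columns
  \<open>configs N T (S - 1) t\<close>, where \<open>1 \<le> S \<le> T\<close>. The values outside these index sets carry
  no meaning.
\<close>

definition P_tplus :: "nat \<Rightarrow> nat \<Rightarrow> nat \<Rightarrow> nat \<Rightarrow> (nat \<Rightarrow> int) \<Rightarrow> (nat \<Rightarrow> int) \<Rightarrow> real" where
  "P_tplus N T S t x y =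
     (if \<forall>i\<in>{1..N}. y i - x i \<in> {0, 1} then
        vandermonde N y
        * (\<Prod>i | i \<in> {1..N} \<and> y i = x i + 1. real_of_int (int N + int S - x i - 1))
        * (\<Prod>i | i \<in> {1..N} \<and> y i = x i. real_of_int (x i + int T - int t - int S))
        / (pochhammer (real T - real t) N * vandermonde N x)
      else 0)"

definition P_Sminus :: "nat \<Rightarrow> nat \<Rightarrow> nat \<Rightarrow> nat \<Rightarrow> (nat \<Rightarrow> int) \<Rightarrow> (nat \<Rightarrow> int) \<Rightarrow> real" where
  "P_Sminus N T S t x y =
     (if \<forall>i\<in>{1..N}. y i - x i \<in> {- 1, 0} then
        vandermonde N y
        * (\<Prod>i | i \<in> {1..N} \<and> y i = x i - 1. real_of_int (x i))
        * (\<Prod>i | i \<in> {1..N} \<and> y i = x i. real_of_int (int S + int N - 1 - x i))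
        / (pochhammer (real S) N * vandermonde N x)
      else 0)"

definition matrix_prod ::
    "'b set \<Rightarrow> ('a \<Rightarrow> 'b \<Rightarrow> real) \<Rightarrow> ('b \<Rightarrow> 'c \<Rightarrow> real) \<Rightarrow> 'a \<Rightarrow> 'c \<Rightarrow> real" where
  "matrix_prod I A B x y = (\<Sum>z\<in>I. A x z * B z y)"

definition P_tplus_Sminus ::
    "nat \<Rightarrow> nat \<Rightarrow> nat \<Rightarrow> nat \<Rightarrow> (nat \<Rightarrow> int) \<Rightarrow> (nat \<Rightarrow> int) \<Rightarrow> real" where
  "P_tplus_Sminus N T S t =
     matrix_prod (configs N T S (t + 1)) (P_tplus N T S t) (P_Sminus N T S (t + 1))"

definition P_step ::
    "nat \<Rightarrow> nat \<Rightarrow> nat \<Rightarrow> (nat \<Rightarrow> nat \<Rightarrow> int) \<Rightarrow> (nat \<Rightarrow> nat \<Rightarrow> int) \<Rightarrow> real" where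
  "P_step N T S X Y =
     (if (\<Prod>t<T. P_tplus_Sminus N T (S + 1) t (Y t) (X (t + 1))) > 0 then
        (\<Prod>t<T. P_tplus N T (S + 1) t (Y t) (Y (t + 1))
               * P_Sminus N T (S + 1) (t + 1) (Y (t + 1)) (X (t + 1))
               / P_tplus_Sminus N T (S + 1) t (Y t) (X (t + 1)))
      else 0)"

end

theory Submission
  imports Defs
begin

text \<open>
  Everything rests on the commutation \<open>P\<^sub>t\<^sub>+ P\<^sub>S\<^sub>- = P\<^sub>S\<^sub>- P\<^sub>t\<^sub>+\<close>. The Vandermonde factors of the
  intermediate configuration cancel, so both sides become sums over strictly increasing chains of
  products of one-particle weights. Such sums are computed particle by particle; the two
  recursions agree because of a linear relation between the sum over all chains and the sums over
  the chains that leave room for a particle directly adjacent to the last one.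

  Row sums: given \<open>X\<close>, the matrix \<open>P\<^sub>S\<^sub>\<mapsto>\<^sub>S\<^sub>+\<^sub>1\<close> runs a Markov chain \<open>Y(0), Y(1), \<dots>\<close>; by commutation
  the denominators stay positive on the configurations that the chain can reach. Column sums: the
  product of the \<open>P\<^sub>t\<^sub>+\<close> along a path family has the same value for all families. Weighting the
  column of \<open>Y\<close> by this product and summing out \<open>X(0), X(1), \<dots>\<close> in turn with the commutation gives
  the corresponding product along \<open>Y\<close> up to a constant. So all column sums are equal, and as all
  rows sum to 1, the uniform measure is mapped to the uniform measure.
\<close>

section \<open>One-particle weights and the product form of the matrices\<close>

text \<open>With \<open>a = N + S - 1\<close> and \<open>b = T - t - S\<close> this is the factor
  that one particle contributes to \<open>P_tplus\<close>; \<open>down_weight\<close> does the same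
  for \<open>P_Sminus\<close>. The value 0 for all other steps absorbs the case distinctions of both
  matrices, so that each entry is a ratio of Vandermonde products times a product over
  particles.\<close>

definition up_weight :: "int \<Rightarrow> int \<Rightarrow> int \<Rightarrow> int \<Rightarrow> real" where
  "up_weight a b x y =
     (if y = x + 1 then real_of_int (a - x) else if y = x then real_of_int (x + b) else 0)"

definition down_weight :: "int \<Rightarrow> int \<Rightarrow> int \<Rightarrow> real" where
  "down_weight a x y =
     (if y = x - 1 then real_of_int x else if y = x then real_of_int (a - x) else 0)"

lemma P_tplus_eq:
  "P_tplus N T S t x y =
     vandermonde N y
     * (\<Prod>i\<in>{1..N}. up_weight (int N + int S - 1) (int T - int t - int S) (x i) (y i))
     / (pochhammer (real T - real t) N * vandermonde N x)"
proof (cases "\<forall>i\<in>{1..N}. y i - x i \<in> {0, 1}")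
  case True
  have "(\<Prod>i | i \<in> {1..N} \<and> y i = x i + 1. real_of_int (int N + int S - x i - 1))
        * (\<Prod>i | i \<in> {1..N} \<and> y i = x i. real_of_int (x i + int T - int t - int S))
      = (\<Prod>i\<in>{1..N}. up_weight (int N + int S - 1) (int T - int t - int S) (x i) (y i))"
    unfolding prod.inter_filter[OF finite_atLeastAtMost] prod.distrib[symmetric]
    by (rule prod.cong[OF refl], use True in \<open>force simp: up_weight_def\<close>)
  then show ?thesis
    using True by (simp add: P_tplus_def mult.assoc)
next
  case False
  then obtain i where "i \<in> {1..N}" "y i \<noteq> x i + 1" "y i \<noteq> x i"
    by force
  then have "(\<Prod>i\<in>{1..N}. up_weight (int N + int S - 1) (int T - int t - int S) (x i) (y i)) = 0"
    by (intro prod_zero) (auto simp: up_weight_def)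
  then show ?thesis
    using False unfolding P_tplus_def by (simp only: if_False)
qed

lemma P_Sminus_eq:
  "P_Sminus N T S t x y =
     vandermonde N y
     * (\<Prod>i\<in>{1..N}. down_weight (int N + int S - 1) (x i) (y i))
     / (pochhammer (real S) N * vandermonde N x)"
proof (cases "\<forall>i\<in>{1..N}. y i - x i \<in> {- 1, 0}")
  case True
  have "(\<Prod>i | i \<in> {1..N} \<and> y i = x i - 1. real_of_int (x i))
        * (\<Prod>i | i \<in> {1..N} \<and> y i = x i. real_of_int (int S + int N - 1 - x i))
      = (\<Prod>i\<in>{1..N}. down_weight (int N + int S - 1) (x i) (y i))"
    unfolding prod.inter_filter[OF finite_atLeastAtMost] prod.distrib[symmetric]
    by (rule prod.cong[OF refl], use True in \<open>force simp: down_weight_def\<close>)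
  then show ?thesis
    using True by (simp add: P_Sminus_def mult.assoc)
next
  case False
  then obtain i where "i \<in> {1..N}" "y i \<noteq> x i - 1" "y i \<noteq> x i"
    by force
  then have "(\<Prod>i\<in>{1..N}. down_weight (int N + int S - 1) (x i) (y i)) = 0"
    by (intro prod_zero) (auto simp: down_weight_def)
  then show ?thesis
    using False unfolding P_Sminus_def by (simp only: if_False)
qed

lemma vandermonde_pos:
  assumes "strict_mono_on {1..N} x"
  shows "vandermonde N x > 0"
  unfolding vandermonde_def
proof (intro prod_pos ballI)
  fix i j assume "i \<in> {1..N}" "j \<in> {i<..N}"
  then show "0 < real_of_int (x j - x i)"
    using strict_mono_onD[OF assms, of i j] by simp
qed

section \<open>Sums over strictly increasing chains\<close>

text \<open>The bound \<open>v\<close> stands for the position of the next particle; it is what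
  makes a recursion on the number of particles possible.\<close>

definition chains_below :: "(nat \<Rightarrow> int set) \<Rightarrow> nat \<Rightarrow> int \<Rightarrow> (nat \<Rightarrow> int) set" where
  "chains_below C n v =
     {y \<in> PiE {1..n} C. strict_mono_on {1..n} y \<and> (\<forall>i\<in>{1..n}. y i < v)}"

definition chain_sum_below ::
    "(nat \<Rightarrow> int set) \<Rightarrow> (nat \<Rightarrow> int \<Rightarrow> real) \<Rightarrow> nat \<Rightarrow> int \<Rightarrow> real" where
  "chain_sum_below C w n v = (\<Sum>y\<in>chains_below C n v. \<Prod>i\<in>{1..n}. w i (y i))"

lemma finite_PiE_family:
  assumes "\<And>i. finite (C i)" "finite I"
  shows "finite (PiE I C)"
  using assms by (intro finite_PiE) auto

lemma finite_chains_below: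
  assumes "\<And>i. finite (C i)"
  shows "finite (chains_below C n v)"
  unfolding chains_below_def using finite_PiE_family[of C "{1..n}"] assms by simp

lemma chain_sum_below_0: "chain_sum_below C w 0 v = 1"
  by (simp add: chain_sum_below_def chains_below_def strict_mono_on_def)

text \<open>Split according to the position \<open>u\<close> of the last particle, which then
  becomes the bound for the remaining ones.\<close>

lemma chain_sum_below_Suc:
  assumes fin: "\<And>i. finite (C i)"
  shows "chain_sum_below C w (Suc n) v =
    (\<Sum>u\<in>{u \<in> C (Suc n). u < v}. w (Suc n) u * chain_sum_below C w n u)"
proof -
  have "(\<Sum>u\<in>{u \<in> C (Suc n). u < v}. w (Suc n) u * chain_sum_below C w n u)
      = (\<Sum>(u, y)\<in>(SIGMA u:{u \<in> C (Suc n). u < v}. chains_below C n u).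
           w (Suc n) u * (\<Prod>i\<in>{1..n}. w i (y i)))"
    using fin finite_chains_below[of C, OF fin]
    by (simp add: chain_sum_below_def sum_distrib_left sum.Sigma)
  also have "\<dots> = chain_sum_below C w (Suc n) v"
    unfolding chain_sum_below_def
  proof (rule sum.reindex_bij_witness[where
        i = "\<lambda>y. (y (Suc n), y(Suc n := undefined))" and j = "\<lambda>(u, y). y(Suc n := u)"])
    fix p assume "p \<in> (SIGMA u:{u \<in> C (Suc n). u < v}. chains_below C n u)"
    then obtain u y where p: "p = (u, y)" and uy: "u \<in> C (Suc n)" "u < v" "y \<in> chains_below C n u"
      by auto
    then show "((case p of (u, y) \<Rightarrow> y(Suc n := u)) (Suc n),
        (case p of (u, y) \<Rightarrow> y(Suc n := u))(Suc n := undefined)) = p"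
      by (auto simp: chains_below_def PiE_def extensional_def)
    have lt: "y i < u" if "i \<in> {1..n}" for i
      using uy(3) that by (simp add: chains_below_def)
    have "(y(Suc n := u)) i < (y(Suc n := u)) j" if "i \<in> {1..Suc n}" "j \<in> {1..Suc n}" "i < j" for i j
    proof (cases "j = Suc n")
      case True
      then show ?thesis using that lt by auto
    next
      case False
      then show ?thesis
        using that uy(3) strict_mono_onD[of "{1..n}" y i j] by (simp add: chains_below_def)
    qed
    then have "strict_mono_on {1..Suc n} (y(Suc n := u))"
      by (auto simp: strict_mono_on_def)
    moreover have "(y(Suc n := u)) i < v" if "i \<in> {1..Suc n}" for i
      using lt[of i] uy(2) that by (cases "i = Suc n") auto
    moreover have "y(Suc n := u) \<in> PiE {1..Suc n} C"
      using uy by (auto simp: chains_below_def PiE_def extensional_def Pi_def)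
    ultimately show "(case p of (u, y) \<Rightarrow> y(Suc n := u)) \<in> chains_below C (Suc n) v"
      unfolding chains_below_def p by simp
    have "(\<Prod>i\<in>{1..Suc n}. w i ((y(Suc n := u)) i))
        = w (Suc n) u * (\<Prod>i\<in>{1..n}. w i ((y(Suc n := u)) i))"
      by (simp add: mult.commute)
    also have "(\<Prod>i\<in>{1..n}. w i ((y(Suc n := u)) i)) = (\<Prod>i\<in>{1..n}. w i (y i))"
      by (rule prod.cong) auto
    finally show "(\<Prod>i\<in>{1..Suc n}. w i ((case p of (u, y) \<Rightarrow> y(Suc n := u)) i))
        = (case p of (u, y) \<Rightarrow> w (Suc n) u * (\<Prod>i\<in>{1..n}. w i (y i)))"
      by (simp add: p)
  next
    fix y assume "y \<in> chains_below C (Suc n) v"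
    then show "(y (Suc n), y(Suc n := undefined))
        \<in> (SIGMA u:{u \<in> C (Suc n). u < v}. chains_below C n u)"
      by (auto simp: chains_below_def PiE_def extensional_def Pi_def strict_mono_on_def)
  qed simp
  finally show ?thesis ..
qed

section \<open>The exchange identity for chains with two sites per particle\<close>

text \<open>A next particle at \<open>f (Suc n) + 1\<close> blocks the upper site of the last one;
  from \<open>f (Suc n) + 2\<close> onwards both sites are free.\<close>

lemma chain_sum_below_pair_Suc:
  assumes "C = (\<lambda>i. {f i, f i + 1})"
  shows "chain_sum_below C w (Suc n) (f (Suc n) + 1)
      = w (Suc n) (f (Suc n)) * chain_sum_below C w n (f (Suc n))"
    and "v \<ge> f (Suc n) + 2 \<Longrightarrow> chain_sum_below C w (Suc n) v
      = w (Suc n) (f (Suc n)) * chain_sum_below C w n (f (Suc n))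
        + w (Suc n) (f (Suc n) + 1) * chain_sum_below C w n (f (Suc n) + 1)"
proof -
  have "{u \<in> C (Suc n). u < f (Suc n) + 1} = {f (Suc n)}"
    using assms by auto
  then show "chain_sum_below C w (Suc n) (f (Suc n) + 1)
      = w (Suc n) (f (Suc n)) * chain_sum_below C w n (f (Suc n))"
    using assms by (subst chain_sum_below_Suc) auto
next
  assume "v \<ge> f (Suc n) + 2"
  then have "{u \<in> C (Suc n). u < v} = {f (Suc n), f (Suc n) + 1}"
    using assms by auto
  then show "chain_sum_below C w (Suc n) v
      = w (Suc n) (f (Suc n)) * chain_sum_below C w n (f (Suc n))
        + w (Suc n) (f (Suc n) + 1) * chain_sum_below C w n (f (Suc n) + 1)"
    using assms by (subst chain_sum_below_Suc) auto
qed

text \<open>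
  Here \<open>s\<close> is the sum over all chains of the preceding particles (the same on both sides), \<open>l\<close> the
  part compatible with moving the current particle from \<open>x\<close> to \<open>x\<close> in the first recursion and \<open>r\<close>
  the part compatible with moving it to \<open>x - 1\<close> in the second. The last conclusion is the hypothesis
  \<open>nonpos\<close> for a next particle at \<open>x + 1\<close>.
\<close>
lemma one_site_exchange:
  fixes a b x z :: int and l r s :: real
  assumes neg: "z < x \<Longrightarrow> l = s \<and> r = s"
    and nonpos: "z \<le> x \<Longrightarrow> b * s = (x + b) * l - x * r"
  defines "wl \<equiv> \<lambda>u. up_weight a b x u * down_weight a u z"
    and "wr \<equiv> \<lambda>u. down_weight a x u * up_weight (a - 1) (b + 1) u z"
  shows "wl x * l + wl (x + 1) * s = wr (x - 1) * r + wr x * s"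
    and "z < x \<Longrightarrow> wl x * l = wl x * l + wl (x + 1) * s"
    and "z < x \<Longrightarrow> wr (x - 1) * r = wl x * l + wl (x + 1) * s"
    and "z \<le> x \<Longrightarrow> b * (wl x * l + wl (x + 1) * s)
      = (x + 1 + b) * (wl x * l) - (x + 1) * (wr (x - 1) * r)"
proof -
  consider "z = x + 1" | "z = x" | "z = x - 1" | "z > x + 1" | "z < x - 1" by linarith
  note cases = this
  show 1: "wl x * l + wl (x + 1) * s = wr (x - 1) * r + wr x * s"
  proof (cases rule: cases)
    case 2
    \<comment> \<open>For \<open>z = x\<close> both sides of the claim contain the factor
      \<open>a - x\<close>, and the remaining identity is a rearrangement of
      \<open>nonpos\<close>.\<close>
    have "(a - x) * (b * s) = (a - x) * ((x + b) * l - x * r)"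
      using nonpos 2 by simp
    then show ?thesis
      using 2 by (simp add: wl_def wr_def up_weight_def down_weight_def algebra_simps)
  next
    case 3
    then show ?thesis
      using neg by (simp add: wl_def wr_def up_weight_def down_weight_def algebra_simps)
  qed (simp_all add: wl_def wr_def up_weight_def down_weight_def algebra_simps)
  show 2: "wl x * l = wl x * l + wl (x + 1) * s" if "z < x"
    using that by (auto simp: wl_def down_weight_def)
  show 3: "wr (x - 1) * r = wl x * l + wl (x + 1) * s" if "z < x"
    using that 1 by (auto simp: wr_def up_weight_def)
  show "b * (wl x * l + wl (x + 1) * s)
      = (x + 1 + b) * (wl x * l) - (x + 1) * (wr (x - 1) * r)" if "z \<le> x"
  proof (cases "z = x")
    case False
    with that have "z < x" by simp
    moreover from this have "wl (x + 1) = 0"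
      by (simp add: wl_def down_weight_def)
    ultimately show ?thesis
      using 3 by (simp add: algebra_simps)
  next
    case True
    have "(a - x) * (x + 1) * (b * s) = (a - x) * (x + 1) * ((x + b) * l - x * r)"
      using nonpos True by simp
    then show ?thesis
      using True by (simp add: wl_def wr_def up_weight_def down_weight_def algebra_simps)
  qed
qed

text \<open>Induction over the particles. \<open>L\<close> belongs to moving up first,
  \<open>R\<close> to moving down first, and \<open>s\<close> is their common unrestricted sum. To
  carry the induction through, the invariant also controls the restricted sums
  \<open>L n (x n + 1)\<close> and \<open>R n (x n)\<close>, which occur when the next particle
  starts at \<open>x n + 1\<close> and keeps particle \<open>n\<close> off its upper site. The
  premises \<open>1 \<le> n\<close> separate off the empty chain, whose sum is 1 for every
  bound.\<close>

lemma chain_sum_exchange: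
  fixes a b :: int and x z :: "nat \<Rightarrow> int" and L R :: "nat \<Rightarrow> int \<Rightarrow> real"
  assumes x: "strict_mono_on {1..N} x" and z: "strict_mono_on {1..N} z"
  defines "L \<equiv> chain_sum_below (\<lambda>i. {x i, x i + 1})
      (\<lambda>i u. up_weight a b (x i) u * down_weight a u (z i))"
    and "R \<equiv> chain_sum_below (\<lambda>i. {x i - 1, x i - 1 + 1})
      (\<lambda>i u. down_weight a (x i) u * up_weight (a - 1) (b + 1) u (z i))"
  assumes "n \<le> N"
  shows "\<exists>s::real. (\<forall>v. (1 \<le> n \<longrightarrow> x n + 2 \<le> v) \<longrightarrow> L n v = s) \<and>
             (\<forall>v. (1 \<le> n \<longrightarrow> x n + 1 \<le> v) \<longrightarrow> R n v = s) \<and>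
             (1 \<le> n \<longrightarrow> z n < x n \<longrightarrow> L n (x n + 1) = s \<and> R n (x n) = s) \<and>
             (1 \<le> n \<longrightarrow> z n \<le> x n \<longrightarrow>
                b * s = (x n + 1 + b) * L n (x n + 1) - (x n + 1) * R n (x n))"
  using \<open>n \<le> N\<close>
proof (induction n)
  case 0
  show ?case by (simp add: L_def R_def chain_sum_below_0)
next
  case (Suc n)
  from Suc.IH[OF Suc_leD[OF Suc.prems]] obtain s :: real where
    Ls: "\<forall>v. (1 \<le> n \<longrightarrow> x n + 2 \<le> v) \<longrightarrow> L n v = s" and
    Rs: "\<forall>v. (1 \<le> n \<longrightarrow> x n + 1 \<le> v) \<longrightarrow> R n v = s" and
    neg: "1 \<le> n \<longrightarrow> z n < x n \<longrightarrow> L n (x n + 1) = s \<and> R n (x n) = s" and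
    nonpos: "1 \<le> n \<longrightarrow> z n \<le> x n \<longrightarrow>
      b * s = (x n + 1 + b) * L n (x n + 1) - (x n + 1) * R n (x n)"
    by (elim exE conjE)
  define x' z' where "x' = x (Suc n)" and "z' = z (Suc n)"
  have lt: "x n < x'" "z n < z'" if "1 \<le> n"
    using that Suc.prems strict_mono_onD[OF x, of n "Suc n"] strict_mono_onD[OF z, of n "Suc n"]
    by (auto simp: x'_def z'_def)
  define wl where "wl = (\<lambda>u. up_weight a b x' u * down_weight a u z')"
  define wr where "wr = (\<lambda>u. down_weight a x' u * up_weight (a - 1) (b + 1) u z')"
  define l r where "l = L n x'" and "r = R n (x' - 1)"
  \<comment> \<open>Unless the new particle starts directly to the right of the previous one, it
    imposes no restriction and \<open>l\<close>, \<open>r\<close> are the full sum.\<close>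
  have linked: "(l = s \<and> r = s) \<or> (1 \<le> n \<and> x' = x n + 1)"
  proof (cases "1 \<le> n \<and> x' = x n + 1")
    case False
    then have "1 \<le> n \<longrightarrow> x n + 2 \<le> x'" using lt by fastforce
    then have "L n x' = s" "R n (x' - 1) = s" using Ls[rule_format, of x'] Rs[rule_format, of "x' - 1"] by auto
    then show ?thesis by (simp add: l_def r_def)
  qed simp
  have neg': "z' < x' \<Longrightarrow> l = s \<and> r = s"
  proof -
    assume "z' < x'"
    then show ?thesis
      using linked
    proof (elim disjE)
      assume *: "1 \<le> n \<and> x' = x n + 1"
      \<comment> \<open>From \<open>z n < z'\<close> and \<open>z' < x n + 1\<close>: for adjacent
        particles the order relation between target and start is inherited by the previous
        particle.\<close>
      then have "z n < x n" using lt(2) \<open>z' < x'\<close> by simp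
      then show ?thesis using * neg by (simp add: l_def r_def)
    qed
  qed
  have nonpos': "z' \<le> x' \<Longrightarrow> b * s = (x' + b) * l - x' * r"
  proof -
    assume "z' \<le> x'"
    then show ?thesis
      using linked
    proof (elim disjE)
      assume "1 \<le> n \<and> x' = x n + 1"
      then show ?thesis
        using nonpos lt \<open>z' \<le> x'\<close> by (simp add: l_def r_def)
    qed (simp add: algebra_simps)
  qed
  note ex = one_site_exchange[where a = a and b = b and x = x' and z = z', OF neg' nonpos']
  have s: "L n (x' + 1) = s" "R n x' = s"
    using Ls[rule_format, of "x' + 1"] Rs[rule_format, of x'] lt by force+
  have L1: "L (Suc n) (x' + 1) = wl x' * l"
    using chain_sum_below_pair_Suc(1)[OF refl, where f = x and n = n]
    by (simp add: L_def x'_def z'_def wl_def l_def)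
  have L2: "L (Suc n) v = wl x' * l + wl (x' + 1) * s" if "x' + 2 \<le> v" for v
    using chain_sum_below_pair_Suc(2)[OF refl, where f = x and n = n and v = v] that
    by (simp add: L_def x'_def z'_def wl_def l_def s(1)[unfolded L_def x'_def, symmetric])
  have R1: "R (Suc n) x' = wr (x' - 1) * r"
    using chain_sum_below_pair_Suc(1)[OF refl, where f = "\<lambda>i. x i - 1" and n = n]
    by (simp add: R_def x'_def z'_def wr_def r_def)
  have R2: "R (Suc n) v = wr (x' - 1) * r + wr x' * s" if "x' + 1 \<le> v" for v
    using chain_sum_below_pair_Suc(2)[OF refl, where f = "\<lambda>i. x i - 1" and n = n and v = v] that
    by (simp add: R_def x'_def z'_def wr_def r_def s(2)[unfolded R_def x'_def, symmetric])
  show ?case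
    unfolding x'_def[symmetric] z'_def[symmetric]
  proof (intro exI[of _ "wl x' * l + wl (x' + 1) * s"] conjI allI impI)
    fix v
    show "L (Suc n) v = wl x' * l + wl (x' + 1) * s" if "1 \<le> Suc n \<longrightarrow> x' + 2 \<le> v"
      using L2 that by simp
    show "R (Suc n) v = wl x' * l + wl (x' + 1) * s" if "1 \<le> Suc n \<longrightarrow> x' + 1 \<le> v"
      using R2 that ex(1) by (simp add: wl_def wr_def)
    show "L (Suc n) (x' + 1) = wl x' * l + wl (x' + 1) * s" if "z' < x'"
      using L1 ex(2) that by (simp add: wl_def)
    show "R (Suc n) x' = wl x' * l + wl (x' + 1) * s" if "z' < x'"
      using R1 ex(3) that by (simp add: wl_def wr_def)
    show "b * (wl x' * l + wl (x' + 1) * s)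
        = (x' + 1 + b) * L (Suc n) (x' + 1) - (x' + 1) * R (Suc n) x'" if "z' \<le> x'"
      unfolding L1 R1 using ex(4) that by (simp add: wl_def wr_def)
  qed
qed

section \<open>Supports and signs of the weights and matrices\<close>

lemma finite_points: "finite (points N T S t)"
  by (rule finite_subset[of _ "{0..int t + int N}"]) (auto simp: points_def)

lemma finite_configs: "finite (configs N T S t)"
proof -
  have "finite ({1..N} \<rightarrow>\<^sub>E points N T S t)"
    by (simp add: finite_PiE finite_points)
  then show ?thesis
    by (simp add: configs_def)
qed

lemma configsD:
  assumes "x \<in> configs N T S t"
  shows "strict_mono_on {1..N} x" and "i \<in> {1..N} \<Longrightarrow> x i \<in> points N T S t"
  using assms by (auto simp: configs_def)

text \<open>The two index sets differ only in families of weight zero: a nonzero product puts every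
  \<open>y i\<close> into both \<open>C i\<close> and \<open>points N T S t\<close>, and then
  \<open>bound\<close> gives \<open>y i < v\<close>. Thus the walls of \<open>points\<close> are
  handled by the weights alone.\<close>

lemma sum_configs_eq_chain_sum:
  assumes fin: "\<And>i. finite (C i)"
    and supp: "\<And>i u. i \<in> {1..N} \<Longrightarrow> w i u \<noteq> 0 \<Longrightarrow> u \<in> C i \<and> u \<in> points N T S t"
    and bound: "\<And>i u. i \<in> {1..N} \<Longrightarrow> u \<in> C i \<Longrightarrow> u < v"
  shows "(\<Sum>y\<in>configs N T S t. \<Prod>i\<in>{1..N}. w i (y i)) = chain_sum_below C w N v"
  unfolding chain_sum_below_def
proof (rule sum.mono_neutral_cong)
  show "finite (configs N T S t)" "finite (chains_below C N v)"
    using finite_configs finite_chains_below fin by blast+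
  show "(\<Prod>i\<in>{1..N}. w i (y i)) = 0" if "y \<in> chains_below C N v - configs N T S t" for y
    using that supp by (force simp: chains_below_def configs_def PiE_def Pi_def intro!: prod_zero)
  show "(\<Prod>i\<in>{1..N}. w i (y i)) = 0" if "y \<in> configs N T S t - chains_below C N v" for y
    using that supp bound by (force simp: chains_below_def configs_def PiE_def Pi_def intro!: prod_zero)
qed simp

text \<open>The linear factors vanish at the walls: \<open>a - x\<close> at the right end
  \<open>x = S + N - 1\<close>, and \<open>x + b\<close> at \<open>x = t + S - T\<close>, which is
  no longer admissible at time \<open>t + 1\<close>.\<close>

lemma up_weight_support:
  assumes "x \<in> points N T S t"
    and "up_weight (int N + int S - 1) (int T - int t - int S) x y \<noteq> 0"
  shows "y \<in> points N T S (t + 1)" "y = x \<or> y = x + 1"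
  using assms by (auto simp: points_def up_weight_def split: if_splits)

lemma down_weight_support:
  assumes "x \<in> points N T (S + 1) t"
    and "down_weight (int N + int (S + 1) - 1) x y \<noteq> 0"
  shows "y \<in> points N T S t" "y = x \<or> y = x - 1"
  using assms by (auto simp: points_def down_weight_def split: if_splits)

lemma up_weight_nonneg:
  assumes "x \<in> points N T S t"
  shows "0 \<le> up_weight (int N + int S - 1) (int T - int t - int S) x y"
  using assms by (auto simp: points_def up_weight_def)

lemma down_weight_nonneg:
  assumes "x \<in> points N T S t"
  shows "0 \<le> down_weight (int N + int S - 1) x y"
  using assms by (auto simp: points_def down_weight_def)

lemma P_tplus_nonneg:
  assumes "t < T" "x \<in> configs N T S t" "y \<in> configs N T S t'"
  shows "0 \<le> P_tplus N T S t x y"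
  unfolding P_tplus_eq
  using assms vandermonde_pos[OF configsD(1)[OF assms(2)]] vandermonde_pos[OF configsD(1)[OF assms(3)]]
  by (intro divide_nonneg_nonneg mult_nonneg_nonneg prod_nonneg ballI up_weight_nonneg
      pochhammer_nonneg) (auto intro: configsD(2))

lemma P_Sminus_nonneg:
  assumes "x \<in> configs N T S t" "y \<in> configs N T S' t" "S > 0"
  shows "0 \<le> P_Sminus N T S t x y"
  unfolding P_Sminus_eq
  using assms vandermonde_pos[OF configsD(1)[OF assms(1)]] vandermonde_pos[OF configsD(1)[OF assms(2)]]
  by (intro divide_nonneg_nonneg mult_nonneg_nonneg prod_nonneg ballI down_weight_nonneg
      pochhammer_nonneg) (auto intro: configsD(2))

lemma P_tplus_pos:
  assumes "t < T" "x \<in> configs N T S t" "y \<in> configs N T S (t + 1)"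
    and step: "\<forall>i\<in>{1..N}. y i - x i \<in> {0, 1}"
  shows "0 < P_tplus N T S t x y"
proof -
  have "0 < up_weight (int N + int S - 1) (int T - int t - int S) (x i) (y i)" if i: "i \<in> {1..N}" for i
  proof -
    have "y i = x i \<or> y i = x i + 1" using step i by force
    then show ?thesis
      using configsD(2)[OF assms(2) i] configsD(2)[OF assms(3) i]
      by (auto simp: points_def up_weight_def)
  qed
  moreover have "0 < pochhammer (real T - real t) N"
    using assms(1) by (intro pochhammer_pos) simp
  ultimately show ?thesis
    unfolding P_tplus_eq
    using vandermonde_pos[OF configsD(1)[OF assms(2)]] vandermonde_pos[OF configsD(1)[OF assms(3)]]
    by (intro divide_pos_pos mult_pos_pos prod_pos ballI) auto
qed

section \<open>The commutation relation and positivity of the denominators\<close>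

text \<open>Once the Vandermonde product of the intermediate configuration cancels, this is
  \<open>chain_sum_exchange\<close> for all \<open>N\<close> particles. Lowering
  \<open>S + 1\<close> to \<open>S\<close> in \<open>P_tplus\<close> replaces \<open>a\<close>,
  \<open>b\<close> by \<open>a - 1\<close>, \<open>b + 1\<close>.\<close>

lemma P_tplus_Sminus_commute:
  assumes x: "x \<in> configs N T (S + 1) t" and z: "z \<in> configs N T S (t + 1)"
  shows "P_tplus_Sminus N T (S + 1) t x z
    = matrix_prod (configs N T S t) (P_Sminus N T (S + 1) t) (P_tplus N T S t) x z"
proof -
  note mono = configsD(1)[OF x] configsD(1)[OF z]
  define a b where "a = int N + int (S + 1) - 1" and "b = int T - int t - int (S + 1)"
  \<comment> \<open>Common to both orders: the normalisation of \<open>P_tplus\<close> does not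
    involve \<open>S\<close>, and that of \<open>P_Sminus\<close> does not involve the time.\<close>
  define c where "c = vandermonde N z /
    (pochhammer (real T - real t) N * pochhammer (real (S + 1)) N * vandermonde N x)"
  have ab: "int N + int S - 1 = a - 1" "int T - int t - int S = b + 1"
    by (simp_all add: a_def b_def)
  have P_eq: "P_tplus N T (S + 1) t x y = vandermonde N y * (\<Prod>i\<in>{1..N}. up_weight a b (x i) (y i))
        / (pochhammer (real T - real t) N * vandermonde N x)"
    "P_Sminus N T (S + 1) t' y' y = vandermonde N y * (\<Prod>i\<in>{1..N}. down_weight a (y' i) (y i))
        / (pochhammer (real (S + 1)) N * vandermonde N y')"
    "P_tplus N T S t y z = vandermonde N z
        * (\<Prod>i\<in>{1..N}. up_weight (a - 1) (b + 1) (y i) (z i))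
        / (pochhammer (real T - real t) N * vandermonde N y)" for t' y' y
    unfolding ab[symmetric] unfolding P_tplus_eq P_Sminus_eq a_def b_def by simp_all
  define wl where "wl = (\<lambda>i u. up_weight a b (x i) u * down_weight a u (z i))"
  define wr where "wr = (\<lambda>i u. down_weight a (x i) u * up_weight (a - 1) (b + 1) u (z i))"
  have bound: "x i \<le> x N" if "i \<in> {1..N}" for i
    using strict_mono_onD[OF mono(1), of i N] that by (cases "i = N") auto
  have "P_tplus_Sminus N T (S + 1) t x z
      = c * (\<Sum>y\<in>configs N T (S + 1) (t + 1). \<Prod>i\<in>{1..N}. wl i (y i))"
    unfolding P_tplus_Sminus_def matrix_prod_def sum_distrib_left
  proof (rule sum.cong)
    fix y assume "y \<in> configs N T (S + 1) (t + 1)"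
    then have "vandermonde N y > 0" by (intro vandermonde_pos configsD(1))
    then show "P_tplus N T (S + 1) t x y * P_Sminus N T (S + 1) (t + 1) y z
        = c * (\<Prod>i\<in>{1..N}. wl i (y i))"
      unfolding P_eq by (simp add: c_def wl_def prod.distrib mult_ac)
  qed simp
  also have "(\<Sum>y\<in>configs N T (S + 1) (t + 1). \<Prod>i\<in>{1..N}. wl i (y i))
      = chain_sum_below (\<lambda>i. {x i, x i + 1}) wl N (x N + 2)"
  proof (rule sum_configs_eq_chain_sum)
    fix i u assume i: "i \<in> {1..N}" and "wl i u \<noteq> 0"
    then have "up_weight a b (x i) u \<noteq> 0" by (simp add: wl_def)
    from up_weight_support[OF configsD(2)[OF x i] this[unfolded a_def b_def]]
    show "u \<in> {x i, x i + 1} \<and> u \<in> points N T (S + 1) (t + 1)" by simp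
  qed (use bound in force)+
  \<comment> \<open>The bound \<open>x N + 2\<close> is large enough for both sums to be
    unrestricted.\<close>
  also have "\<dots> = chain_sum_below (\<lambda>i. {x i - 1, x i - 1 + 1}) wr N (x N + 2)"
    using chain_sum_exchange[OF mono order_refl, of a b] unfolding wl_def wr_def by force
  also have "\<dots> = (\<Sum>y\<in>configs N T S t. \<Prod>i\<in>{1..N}. wr i (y i))"
  proof (rule sum_configs_eq_chain_sum[symmetric])
    fix i u assume i: "i \<in> {1..N}" and "wr i u \<noteq> 0"
    then have "down_weight a (x i) u \<noteq> 0" by (simp add: wr_def)
    from down_weight_support[OF configsD(2)[OF x i] this[unfolded a_def]]
    show "u \<in> {x i - 1, x i - 1 + 1} \<and> u \<in> points N T S t" by auto
  qed (use bound in force)+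
  also have "c * \<dots> = matrix_prod (configs N T S t) (P_Sminus N T (S + 1) t) (P_tplus N T S t) x z"
    unfolding matrix_prod_def sum_distrib_left
  proof (rule sum.cong)
    fix y assume "y \<in> configs N T S t"
    then have "vandermonde N y > 0" by (intro vandermonde_pos configsD(1))
    then show "c * (\<Prod>i\<in>{1..N}. wr i (y i))
        = P_Sminus N T (S + 1) t x y * P_tplus N T S t y z"
      unfolding P_eq by (simp add: c_def wr_def prod.distrib mult_ac)
  qed simp
  finally show ?thesis .
qed

lemma matrix_prod_nonneg:
  assumes "\<And>z. z \<in> I \<Longrightarrow> 0 \<le> A x z" "\<And>z. z \<in> I \<Longrightarrow> 0 \<le> B z y"
  shows "0 \<le> matrix_prod I A B x y"
  unfolding matrix_prod_def using assms by (intro sum_nonneg mult_nonneg_nonneg)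

lemma matrix_prod_pos:
  assumes "finite I" "z \<in> I" "0 < A x z" "0 < B z y"
    and "\<And>z. z \<in> I \<Longrightarrow> 0 \<le> A x z" "\<And>z. z \<in> I \<Longrightarrow> 0 \<le> B z y"
  shows "0 < matrix_prod I A B x y"
  unfolding matrix_prod_def using assms by (intro sum_pos2[of _ z]) auto

lemma P_tplus_Sminus_nonneg:
  assumes "t < T" "x \<in> configs N T (S + 1) t" "z \<in> configs N T S (t + 1)"
  shows "0 \<le> P_tplus_Sminus N T (S + 1) t x z"
  unfolding P_tplus_Sminus_def
  using assms by (intro matrix_prod_nonneg P_tplus_nonneg P_Sminus_nonneg) auto

lemma P_tplus_Sminus_pos:
  assumes "t < T" "x \<in> configs N T (S + 1) t" "z \<in> configs N T S (t + 1)"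
    and "y \<in> configs N T (S + 1) (t + 1)"
    and "0 < P_tplus N T (S + 1) t x y" "0 < P_Sminus N T (S + 1) (t + 1) y z"
  shows "0 < P_tplus_Sminus N T (S + 1) t x z"
  unfolding P_tplus_Sminus_def
  using assms by (intro matrix_prod_pos[of _ y] finite_configs P_tplus_nonneg P_Sminus_nonneg) auto

text \<open>By commutation a witness for the other order of the factors suffices; this is how the
  denominators are controlled before the next configuration is chosen.\<close>

lemma P_Sminus_tplus_pos:
  assumes "t < T" "x \<in> configs N T (S + 1) t" "z \<in> configs N T S (t + 1)"
    and "y \<in> configs N T S t"
    and "0 < P_Sminus N T (S + 1) t x y" "0 < P_tplus N T S t y z"
  shows "0 < P_tplus_Sminus N T (S + 1) t x z"
  unfolding P_tplus_Sminus_commute[OF assms(2,3)]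
  using assms by (intro matrix_prod_pos[of _ y] finite_configs P_tplus_nonneg P_Sminus_nonneg) auto

section \<open>Configurations at the end times and path families\<close>

lemma strict_mono_on_int_diff_ge:
  fixes x :: "nat \<Rightarrow> int"
  assumes "strict_mono_on {1..N} x" "1 \<le> i" "i \<le> j" "j \<le> N"
  shows "int j - int i \<le> x j - x i"
  using assms(3,4)
proof (induction j rule: dec_induct)
  case (step j)
  then show ?case
    using strict_mono_onD[OF assms(1), of j "Suc j"] assms(2) by simp
qed simp

lemma strict_mono_on_packed:
  fixes x :: "nat \<Rightarrow> int"
  assumes "strict_mono_on {1..N} x" "i \<in> {1..N}"
    and "\<And>i. i \<in> {1..N} \<Longrightarrow> c \<le> x i" "\<And>i. i \<in> {1..N} \<Longrightarrow> x i \<le> c + int N - 1"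
  shows "x i = c + int i - 1"
  using strict_mono_on_int_diff_ge[OF assms(1), of 1 i]
    strict_mono_on_int_diff_ge[OF assms(1), of i N] assms(2) assms(3)[of 1] assms(4)[of N]
  by force

text \<open>At the times \<open>0\<close> and \<open>T\<close> the set \<open>points\<close> has
  exactly \<open>N\<close> elements, so this is the only configuration there, with
  \<open>c = 0\<close> and \<open>c = S\<close> respectively.\<close>

definition packed_config :: "nat \<Rightarrow> nat \<Rightarrow> nat \<Rightarrow> int" where
  "packed_config N c = (\<lambda>i\<in>{1..N}. int c + int i - 1)"

lemma packed_configI:
  assumes "strict_mono_on {1..N} x" "x \<in> {1..N} \<rightarrow>\<^sub>E {int c..int c + int N - 1}"
  shows "x = packed_config N c"
proof (rule extensionalityI[of _ "{1..N}"])
  show "x i = packed_config N c i" if "i \<in> {1..N}" for i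
    using strict_mono_on_packed[OF assms(1) that, of "int c"] assms(2) that
    by (auto simp: packed_config_def PiE_def Pi_def)
qed (use assms in \<open>auto simp: packed_config_def PiE_def\<close>)

lemma configs_eq_packed:
  assumes "points N T S t = {int c..int c + int N - 1}"
  shows "configs N T S t = {packed_config N c}"
proof -
  have "packed_config N c \<in> configs N T S t"
    by (auto simp: configs_def assms packed_config_def strict_mono_on_def)
  then show ?thesis
    using packed_configI[of N _ c] by (auto simp: configs_def assms)
qed

lemma configs_initial: "S \<le> T \<Longrightarrow> configs N T S 0 = {packed_config N 0}"
  by (rule configs_eq_packed) (auto simp: points_def)

lemma configs_final: "S \<le> T \<Longrightarrow> configs N T S T = {packed_config N S}"
  by (rule configs_eq_packed) (auto simp: points_def)

lemma lazy_path_bounds: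
  fixes p :: "nat \<Rightarrow> int"
  assumes "\<forall>t<T. p (t + 1) - p t \<in> {0, 1}" "s \<le> t" "t \<le> T"
  shows "p s \<le> p t \<and> p t \<le> p s + (int t - int s)"
  using assms(2,3)
proof (induction t rule: dec_induct)
  case (step t)
  then show ?case using assms(1)[rule_format, of t] by auto
qed simp

text \<open>The end conditions are encoded in \<open>configs\<close>, which is a singleton at both
  end times. Conversely, a path with steps 0 or 1 and the prescribed ends stays inside
  \<open>points\<close>. Sums over path families thereby become sums over a product set.\<close>

lemma paths_eq:
  assumes "S \<le> T"
  shows "paths N T S = {X \<in> PiE {0..T} (configs N T S).
    \<forall>t<T. \<forall>i\<in>{1..N}. X (t + 1) i - X t i \<in> {0, 1}}" (is "_ = ?R")
proof (intro equalityI subsetI)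
  fix X assume X: "X \<in> paths N T S"
  have "X t \<in> configs N T S t" if t: "t \<le> T" for t
  proof -
    have "X t i \<in> points N T S t" if i: "i \<in> {1..N}" for i
    proof -
      have "\<forall>t<T. X (t + 1) i - X t i \<in> {0, 1}" "X 0 i = int i - 1" "X T i = int S + int i - 1"
        using X i by (auto simp: paths_def)
      then show ?thesis
        using lazy_path_bounds[of T "\<lambda>t. X t i" 0 t] lazy_path_bounds[of T "\<lambda>t. X t i" t T] i t
        by (auto simp: points_def)
    qed
    moreover have "X t \<in> {1..N} \<rightarrow>\<^sub>E UNIV" "strict_mono_on {1..N} (X t)"
      using X t by (auto simp: paths_def)
    ultimately show ?thesis
      by (auto simp: configs_def PiE_def Pi_def)
  qed
  then show "X \<in> ?R"
    using X by (auto simp: paths_def PiE_def Pi_def)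
next
  fix X assume X: "X \<in> ?R"
  then have "X 0 \<in> configs N T S 0" "X T \<in> configs N T S T" by auto
  then have "X 0 = packed_config N 0" "X T = packed_config N S"
    using assms by (simp_all add: configs_initial configs_final)
  with X show "X \<in> paths N T S"
    by (fastforce simp: paths_def packed_config_def configs_def PiE_def Pi_def)
qed

lemma pathsD:
  assumes "X \<in> paths N T S" "S \<le> T"
  shows "t \<le> T \<Longrightarrow> X t \<in> configs N T S t"
    and "X 0 = packed_config N 0" and "X T = packed_config N S"
    and "t < T \<Longrightarrow> 0 < P_tplus N T S t (X t) (X (t + 1))"
proof -
  show cf: "X t \<in> configs N T S t" if "t \<le> T" for t
    using assms that by (auto simp: paths_eq)
  show "X 0 = packed_config N 0" "X T = packed_config N S"
    using cf[of 0] cf[of T] assms by (simp_all add: configs_initial configs_final)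
  show "0 < P_tplus N T S t (X t) (X (t + 1))" if "t < T"
    using that assms by (intro P_tplus_pos cf) (auto simp: paths_eq)
qed

lemma finite_paths: "S \<le> T \<Longrightarrow> finite (paths N T S)"
  by (simp add: paths_eq finite_PiE finite_configs)

lemma paths_nonempty:
  assumes "S \<le> T"
  shows "paths N T S \<noteq> {}"
proof -
  \<comment> \<open>All particles jump in each of the first \<open>S\<close> steps and rest
    afterwards.\<close>
  have "(\<lambda>t\<in>{0..T}. packed_config N (min t S)) \<in> paths N T S"
    using assms by (auto simp: paths_def packed_config_def strict_mono_on_def)
  then show ?thesis by blast
qed

text \<open>Allows sums over \<open>paths\<close> to be extended to the whole product set.\<close>

lemma prod_P_tplus_eq_0:
  assumes "S \<le> T" "X \<in> PiE {0..T} (configs N T S) - paths N T S"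
  shows "(\<Prod>t<T. P_tplus N T S t (X t) (X (t + 1))) = 0"
proof -
  obtain t where "t < T" "\<not> (\<forall>i\<in>{1..N}. X (t + 1) i - X t i \<in> {0, 1})"
    using assms by (auto simp: paths_eq)
  then show ?thesis
    by (intro prod_zero bexI[of _ t]) (auto simp: P_tplus_def)
qed

section \<open>The constant weight of path families\<close>

text \<open>A jump preceded by \<open>k\<close> jumps starts at \<open>p 0 + k\<close> and
  contributes \<open>a - p 0 - k\<close>. A rest preceded by \<open>k\<close> rests contributes
  \<open>p 0 + b - k\<close>, since position minus time is then \<open>p 0 - k\<close>. So only the
  numbers of jumps and rests matter, not their order.\<close>

lemma prod_up_weight_lazy_path:
  fixes p :: "nat \<Rightarrow> int"
  assumes "\<forall>t<n. p (t + 1) - p t \<in> {0, 1}"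
  shows "(\<Prod>t<n. up_weight a (b - int t) (p t) (p (t + 1)))
    = (\<Prod>k<nat (p n - p 0). real_of_int (a - p 0 - int k))
      * (\<Prod>k<n - nat (p n - p 0). real_of_int (p 0 + b - int k))"
  using assms
proof (induction n)
  case (Suc n)
  define u where "u = nat (p n - p 0)"
  have bounds: "p n = p 0 + int u" "u \<le> n"
    using lazy_path_bounds[of n p 0 n] Suc.prems by (auto simp: u_def)
  have IH: "(\<Prod>t<n. up_weight a (b - int t) (p t) (p (t + 1)))
      = (\<Prod>k<u. real_of_int (a - p 0 - int k)) * (\<Prod>k<n - u. real_of_int (p 0 + b - int k))"
    using Suc by (simp add: u_def)
  consider "p (n + 1) = p n + 1" | "p (n + 1) = p n"
    using Suc.prems by force
  then show ?case
  proof cases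
    case 1
    then have "nat (p (Suc n) - p 0) = Suc u" using bounds by simp
    moreover have "up_weight a (b - int n) (p n) (p (n + 1)) = real_of_int (a - p 0 - int u)"
      using 1 bounds by (simp add: up_weight_def)
    ultimately show ?thesis
      using IH by simp
  next
    case 2
    then have "nat (p (Suc n) - p 0) = u" using bounds by simp
    moreover have "up_weight a (b - int n) (p n) (p (n + 1)) = real_of_int (p 0 + b - int (n - u))"
      using 2 bounds by (simp add: up_weight_def)
    moreover have "Suc n - u = Suc (n - u)"
      using bounds by simp
    ultimately show ?thesis
      using IH by simp
  qed
qed simp

text \<open>The Vandermonde ratios telescope, and the particle factors depend only on the end
  points, which all families share.\<close>

lemma prod_P_tplus_path:
  assumes X: "X \<in> paths N T S" and X': "X' \<in> paths N T S" and ST: "S \<le> T"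
  shows "(\<Prod>t<T. P_tplus N T S t (X t) (X (t + 1))) = (\<Prod>t<T. P_tplus N T S t (X' t) (X' (t + 1)))"
proof -
  define a b where "a = int N + int S - 1" and "b = int T - int S"
  define e where "e = (\<lambda>i. (\<Prod>k<nat (packed_config N S i - packed_config N 0 i).
        real_of_int (a - packed_config N 0 i - int k))
      * (\<Prod>k<T - nat (packed_config N S i - packed_config N 0 i).
          real_of_int (packed_config N 0 i + b - int k)))"
  have "(\<Prod>t<T. P_tplus N T S t (X t) (X (t + 1)))
      = vandermonde N (packed_config N S) / vandermonde N (packed_config N 0)
        * (\<Prod>i\<in>{1..N}. e i) / (\<Prod>t<T. pochhammer (real T - real t) N)"
    if X: "X \<in> paths N T S" for X
  proof -
    note D = pathsD[OF X ST]
    have "vandermonde N (X t) \<noteq> 0" if "t \<le> T" for t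
      using vandermonde_pos[OF configsD(1)[OF D(1)[OF that]]] by simp
    then have vdm: "(\<Prod>t<T. vandermonde N (X (t + 1)) / vandermonde N (X t))
        = vandermonde N (X T) / vandermonde N (X 0)"
      using prod_lessThan_telescope[of T "\<lambda>t. vandermonde N (X t)"] by simp
    have "(\<Prod>t<T. \<Prod>i\<in>{1..N}. up_weight a (b - int t) (X t i) (X (t + 1) i)) = (\<Prod>i\<in>{1..N}. e i)"
    proof (subst prod.swap, rule prod.cong[OF refl])
      fix i assume "i \<in> {1..N}"
      then show "(\<Prod>t<T. up_weight a (b - int t) (X t i) (X (t + 1) i)) = e i"
        using prod_up_weight_lazy_path[of T "\<lambda>t. X t i" a b] X D(2,3) ST
        by (simp add: paths_eq e_def)
    qed
    moreover have "P_tplus N T S t (X t) (X (t + 1)) = vandermonde N (X (t + 1)) / vandermonde N (X t)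
        * (\<Prod>i\<in>{1..N}. up_weight a (b - int t) (X t i) (X (t + 1) i)) / pochhammer (real T - real t) N" for t
      by (simp add: P_tplus_eq a_def b_def algebra_simps)
    moreover from this have "(\<Prod>t<T. P_tplus N T S t (X t) (X (t + 1)))
        = (\<Prod>t<T. vandermonde N (X (t + 1)) / vandermonde N (X t))
          * (\<Prod>t<T. \<Prod>i\<in>{1..N}. up_weight a (b - int t) (X t i) (X (t + 1) i))
          / (\<Prod>t<T. pochhammer (real T - real t) N)"
      by (simp add: prod.distrib prod_dividef)
    ultimately show ?thesis
      unfolding vdm D(2,3) by simp
  qed
  from this[OF X] this[OF X'] show ?thesis by simp
qed

section \<open>Iterated sums over trajectories\<close>

lemma sum_PiE_atLeast0_Suc:
  "(\<Sum>X\<in>PiE {0..Suc n} Q. f X) = (\<Sum>X\<in>PiE {0..n} Q. \<Sum>b\<in>Q (Suc n). f (X(Suc n := b)))"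
proof -
  have "(\<Sum>X\<in>PiE {0..n} Q. \<Sum>b\<in>Q (Suc n). f (X(Suc n := b)))
      = (\<Sum>(X, b)\<in>PiE {0..n} Q \<times> Q (Suc n). f (X(Suc n := b)))"
    by (rule sum.cartesian_product)
  also have "\<dots> = (\<Sum>X\<in>PiE {0..Suc n} Q. f X)"
    by (rule sum.reindex_bij_witness[where
        i = "\<lambda>X. (X(Suc n := undefined), X (Suc n))" and j = "\<lambda>(X, b). X(Suc n := b)"]) (auto simp: PiE_def Pi_def extensional_def)
  finally show ?thesis ..
qed

lemma prod_lessThan_fun_upd:
  "(\<Prod>t<n. k t ((X(Suc n := b)) t) ((X(Suc n := b)) (t + 1))) = (\<Prod>t<n. k t (X t) (X (t + 1)))"
  by (rule prod.cong) auto

text \<open>Total mass of a Markov chain with kernels \<open>k\<close>, started once from each state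
  of \<open>Q 0\<close>. The predicate \<open>R\<close> marks reachable states: rows have to sum to
  1 only there, as a kernel with vanishing denominators may fail to be stochastic elsewhere.\<close>

lemma sum_paths_forward:
  fixes k :: "nat \<Rightarrow> 'a \<Rightarrow> 'a \<Rightarrow> real"
  assumes init: "\<And>a. a \<in> Q 0 \<Longrightarrow> R 0 a"
    and stoch: "\<And>t a. t < n \<Longrightarrow> a \<in> Q t \<Longrightarrow> R t a \<Longrightarrow> (\<Sum>b\<in>Q (t + 1). k t a b) = 1"
    and reach: "\<And>t a b. t < n \<Longrightarrow> a \<in> Q t \<Longrightarrow> b \<in> Q (t + 1) \<Longrightarrow> R t a \<Longrightarrow> k t a b \<noteq> 0 \<Longrightarrow> R (t + 1) b"
  shows "(\<Sum>X\<in>PiE {0..n} Q. \<Prod>t<n. k t (X t) (X (t + 1))) = card (Q 0)"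
  using stoch reach
proof (induction n)
  case 0
  then show ?case by (simp add: card_PiE)
next
  case (Suc n)
  note reach = Suc.prems(2)
  have R: "R t (X t)" if "X \<in> PiE {0..n} Q" "(\<Prod>t<n. k t (X t) (X (t + 1))) \<noteq> 0" "t \<le> n" for X t
    using \<open>t \<le> n\<close>
  proof (induction t)
    case 0
    then show ?case using init PiE_mem[OF that(1), of 0] by simp
  next
    case (Suc t)
    then have "k t (X t) (X (t + 1)) \<noteq> 0" using that by (simp add: prod_zero_iff)
    moreover have "X t \<in> Q t" "X (t + 1) \<in> Q (t + 1)"
      using PiE_mem[OF that(1), of t] PiE_mem[OF that(1), of "t + 1"] Suc.prems by simp_all
    ultimately show ?case
      using reach[of t "X t" "X (t + 1)"] Suc by simp
  qed
  have "(\<Sum>X\<in>PiE {0..Suc n} Q. \<Prod>t<Suc n. k t (X t) (X (t + 1)))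
      = (\<Sum>X\<in>PiE {0..n} Q. (\<Prod>t<n. k t (X t) (X (t + 1))) * (\<Sum>b\<in>Q (n + 1). k n (X n) b))"
    by (simp add: sum_PiE_atLeast0_Suc prod_lessThan_fun_upd[simplified] sum_distrib_left)
  also have "\<dots> = (\<Sum>X\<in>PiE {0..n} Q. \<Prod>t<n. k t (X t) (X (t + 1)))"
  proof (rule sum.cong[OF refl])
    fix X assume X: "X \<in> PiE {0..n} Q"
    show "(\<Prod>t<n. k t (X t) (X (t + 1))) * (\<Sum>b\<in>Q (n + 1). k n (X n) b)
        = (\<Prod>t<n. k t (X t) (X (t + 1)))"
      using Suc.prems(1)[of n "X n"] R[OF X, of n] PiE_mem[OF X, of n] by (cases "(\<Prod>t<n. k t (X t) (X (t + 1))) = 0") auto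
  qed
  also have "\<dots> = card (Q 0)"
    using Suc.prems by (intro Suc.IH) auto
  finally show ?case .
qed

text \<open>The kernels \<open>h\<close> carry the row vector \<open>v t\<close> to
  \<open>v (t + 1)\<close>. The function \<open>g\<close> is there for the induction, where the sum
  over the final state is absorbed into it.\<close>

lemma sum_paths_intertwine:
  fixes h :: "nat \<Rightarrow> 'a \<Rightarrow> 'a \<Rightarrow> real" and v :: "nat \<Rightarrow> 'a \<Rightarrow> real"
  assumes "\<And>t b. t < n \<Longrightarrow> b \<in> Q (t + 1) \<Longrightarrow> (\<Sum>a\<in>Q t. v t a * h t a b) = v (t + 1) b"
  shows "(\<Sum>X\<in>PiE {0..n} Q. v 0 (X 0) * (\<Prod>t<n. h t (X t) (X (t + 1))) * g (X n))
    = (\<Sum>b\<in>Q n. v n b * g b)"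
  using assms
proof (induction n arbitrary: g)
  case 0
  show ?case
    by (rule sum.reindex_bij_witness[where i = "\<lambda>b. \<lambda>t\<in>{0}. b" and j = "\<lambda>X. X 0"])
      (auto simp: PiE_def extensional_def)
next
  case (Suc n)
  have "(\<Sum>X\<in>PiE {0..Suc n} Q. v 0 (X 0) * (\<Prod>t<Suc n. h t (X t) (X (t + 1))) * g (X (Suc n)))
      = (\<Sum>X\<in>PiE {0..n} Q. v 0 (X 0) * (\<Prod>t<n. h t (X t) (X (t + 1)))
          * (\<Sum>b\<in>Q (n + 1). h n (X n) b * g b))"
    by (simp add: sum_PiE_atLeast0_Suc prod_lessThan_fun_upd[simplified] sum_distrib_left mult_ac)
  also have "\<dots> = (\<Sum>a\<in>Q n. v n a * (\<Sum>b\<in>Q (n + 1). h n a b * g b))"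
    using Suc.prems by (intro Suc.IH) auto
  also have "\<dots> = (\<Sum>b\<in>Q (n + 1). (\<Sum>a\<in>Q n. v n a * h n a b) * g b)"
    unfolding sum_distrib_left sum_distrib_right by (subst sum.swap) (simp add: mult_ac)
  also have "\<dots> = (\<Sum>b\<in>Q (n + 1). v (n + 1) b * g b)"
    using Suc.prems by (intro sum.cong) auto
  finally show ?case by simp
qed

section \<open>Row sums and column sums of the transition matrix\<close>

text \<open>The denominators are nonnegative, so if their product is not positive, one of them is 0;
  as division by 0 yields 0, the product formula then gives 0 as well.\<close>

lemma P_step_eq:
  assumes "S < T" "X \<in> PiE {0..T} (configs N T S)" "Y \<in> PiE {0..T} (configs N T (S + 1))"
  shows "P_step N T S X Y =
    (\<Prod>t<T. P_tplus N T (S + 1) t (Y t) (Y (t + 1))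
      * P_Sminus N T (S + 1) (t + 1) (Y (t + 1)) (X (t + 1))
      / P_tplus_Sminus N T (S + 1) t (Y t) (X (t + 1)))" (is "_ = prod ?f _")
proof (cases "(\<Prod>t<T. P_tplus_Sminus N T (S + 1) t (Y t) (X (t + 1))) > 0")
  case False
  moreover have "(\<Prod>t<T. P_tplus_Sminus N T (S + 1) t (Y t) (X (t + 1))) \<ge> 0"
    using assms by (intro prod_nonneg ballI P_tplus_Sminus_nonneg) auto
  ultimately have "(\<Prod>t<T. P_tplus_Sminus N T (S + 1) t (Y t) (X (t + 1))) = 0"
    by linarith
  then have "prod ?f {..<T} = 0"
    by auto
  then show ?thesis
    using False by (simp add: P_step_def)
qed (simp add: P_step_def)

lemma P_step_nonneg:
  assumes "S < T" "X \<in> PiE {0..T} (configs N T S)" "Y \<in> PiE {0..T} (configs N T (S + 1))"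
  shows "0 \<le> P_step N T S X Y"
  unfolding P_step_eq[OF assms]
  using assms
  by (intro prod_nonneg ballI divide_nonneg_nonneg mult_nonneg_nonneg P_tplus_nonneg
      P_Sminus_nonneg P_tplus_Sminus_nonneg) auto

lemma P_Sminus_initial_pos: "0 < P_Sminus N T (S + 1) 0 (packed_config N 0) (packed_config N 0)"
proof -
  have "0 < vandermonde N (packed_config N 0)"
    by (intro vandermonde_pos) (auto simp: packed_config_def strict_mono_on_def)
  moreover have "0 < pochhammer (real (S + 1)) N"
    by (intro pochhammer_pos) simp
  moreover have "0 < (\<Prod>i\<in>{1..N}. down_weight (int N + int (S + 1) - 1)
      (packed_config N 0 i) (packed_config N 0 i))"
    by (intro prod_pos) (auto simp: down_weight_def packed_config_def)
  ultimately show ?thesis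
    unfolding P_Sminus_eq by (intro divide_pos_pos mult_pos_pos)
qed

lemma P_step_row_sum:
  assumes "S < T" and X: "X \<in> paths N T S"
  shows "(\<Sum>Y\<in>paths N T (S + 1). P_step N T S X Y) = 1"
proof -
  let ?Q = "configs N T (S + 1)"
  note D = pathsD[OF X less_imp_le[OF \<open>S < T\<close>]]
  have XP: "X \<in> PiE {0..T} (configs N T S)"
    using X \<open>S < T\<close> by (simp add: paths_eq)
  define k where "k = (\<lambda>t a b. P_tplus N T (S + 1) t a b
      * P_Sminus N T (S + 1) (t + 1) b (X (t + 1)) / P_tplus_Sminus N T (S + 1) t a (X (t + 1)))"
  have "(\<Sum>Y\<in>paths N T (S + 1). P_step N T S X Y) = (\<Sum>Y\<in>PiE {0..T} ?Q. P_step N T S X Y)"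
  proof (rule sum.mono_neutral_left)
    show "\<forall>Y\<in>PiE {0..T} ?Q - paths N T (S + 1). P_step N T S X Y = 0"
    proof
      fix Y assume Y: "Y \<in> PiE {0..T} ?Q - paths N T (S + 1)"
      then have "(\<Prod>t<T. P_tplus N T (S + 1) t (Y t) (Y (t + 1))) = 0"
        using \<open>S < T\<close> by (intro prod_P_tplus_eq_0) auto
      then show "P_step N T S X Y = 0"
        using Y by (subst P_step_eq[OF \<open>S < T\<close> XP]) (auto simp: prod_dividef prod.distrib)
    qed
  qed (use \<open>S < T\<close> in \<open>auto simp: paths_eq intro!: finite_PiE finite_configs\<close>)
  also have "\<dots> = (\<Sum>Y\<in>PiE {0..T} ?Q. \<Prod>t<T. k t (Y t) (Y (t + 1)))"
    unfolding k_def by (intro sum.cong refl P_step_eq[OF \<open>S < T\<close> XP])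
  also have "\<dots> = card (?Q 0)"
  \<comment> \<open>Reachable states \<open>a\<close> are those from which \<open>P_Sminus\<close>
    can lead to \<open>X t\<close>. The step of \<open>X\<close> from \<open>t\<close> to
    \<open>t + 1\<close> then makes the next denominator positive, so the row sum is a nonzero
    number divided by itself.\<close>
  proof (rule sum_paths_forward[where R = "\<lambda>t a. 0 < P_Sminus N T (S + 1) t a (X t)"])
    fix a assume "a \<in> ?Q 0"
    then show "0 < P_Sminus N T (S + 1) 0 a (X 0)"
      using P_Sminus_initial_pos D(2) \<open>S < T\<close> by (simp add: configs_initial)
  next
    fix t a assume t: "t < T" and a: "a \<in> ?Q t" "0 < P_Sminus N T (S + 1) t a (X t)"
    then have "0 < P_tplus_Sminus N T (S + 1) t a (X (t + 1))"
      using D(4)[OF t] D(1)[of t] D(1)[of "t + 1"] by (intro P_Sminus_tplus_pos[where y = "X t"]) auto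
    moreover have "(\<Sum>b\<in>?Q (t + 1). k t a b)
        = P_tplus_Sminus N T (S + 1) t a (X (t + 1)) / P_tplus_Sminus N T (S + 1) t a (X (t + 1))"
      unfolding k_def sum_divide_distrib[symmetric] by (simp add: P_tplus_Sminus_def matrix_prod_def)
    ultimately show "(\<Sum>b\<in>?Q (t + 1). k t a b) = 1" by simp
  next
    fix t a b assume "t < T" "b \<in> ?Q (t + 1)" "k t a b \<noteq> 0"
    then have "P_Sminus N T (S + 1) (t + 1) b (X (t + 1)) \<noteq> 0"
      "0 \<le> P_Sminus N T (S + 1) (t + 1) b (X (t + 1))"
      using D(1)[of "t + 1"] by (auto simp: k_def intro!: P_Sminus_nonneg)
    then show "0 < P_Sminus N T (S + 1) (t + 1) b (X (t + 1))" by simp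
  qed
  also have "\<dots> = 1"
    using \<open>S < T\<close> by (simp add: configs_initial)
  finally show ?thesis .
qed

text \<open>With \<open>v t\<close> the row of \<open>P_Sminus\<close> at \<open>Y t\<close>,
  commutation says that \<open>h\<close> carries \<open>v t\<close> to \<open>v (t + 1)\<close>. The
  extra factor on the left is the initial value \<open>v 0\<close>, and the one on the right the
  final value \<open>v T\<close>, each at the only possible configuration.\<close>

lemma P_step_weighted_column_sum:
  assumes "S < T" and Y: "Y \<in> paths N T (S + 1)"
  shows "(\<Sum>X\<in>paths N T S. P_step N T S X Y * (\<Prod>t<T. P_tplus N T S t (X t) (X (t + 1))))
      * P_Sminus N T (S + 1) 0 (packed_config N 0) (packed_config N 0)
    = (\<Prod>t<T. P_tplus N T (S + 1) t (Y t) (Y (t + 1)))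
      * P_Sminus N T (S + 1) T (packed_config N (S + 1)) (packed_config N S)"
proof -
  let ?Q = "configs N T S"
  have "S + 1 \<le> T" using \<open>S < T\<close> by simp
  note D = pathsD[OF Y this]
  have YP: "Y \<in> PiE {0..T} (configs N T (S + 1))"
    using Y \<open>S < T\<close> by (simp add: paths_eq)
  define v where "v = (\<lambda>t. P_Sminus N T (S + 1) t (Y t))"
  define h where "h = (\<lambda>t a b. v (t + 1) b * P_tplus N T S t a b / P_tplus_Sminus N T (S + 1) t (Y t) b)"
  define c where "c = (\<Prod>t<T. P_tplus N T (S + 1) t (Y t) (Y (t + 1)))"
  have eq: "P_step N T S X Y * (\<Prod>t<T. P_tplus N T S t (X t) (X (t + 1))) * v 0 (X 0)
      = c * (v 0 (X 0) * (\<Prod>t<T. h t (X t) (X (t + 1))) * 1)" if "X \<in> PiE {0..T} ?Q" for X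
    by (simp add: P_step_eq[OF \<open>S < T\<close> that YP] h_def v_def c_def prod_dividef prod.distrib)
  have X0: "X 0 = packed_config N 0" if "X \<in> PiE {0..T} ?Q" for X
    using that PiE_mem[OF that, of 0] \<open>S < T\<close> by (simp add: configs_initial)
  have extend: "(\<Sum>X\<in>paths N T S. P_step N T S X Y * (\<Prod>t<T. P_tplus N T S t (X t) (X (t + 1))))
      = (\<Sum>X\<in>PiE {0..T} ?Q. P_step N T S X Y * (\<Prod>t<T. P_tplus N T S t (X t) (X (t + 1))))"
  proof (rule sum.mono_neutral_left)
    show "\<forall>X\<in>PiE {0..T} ?Q - paths N T S.
        P_step N T S X Y * (\<Prod>t<T. P_tplus N T S t (X t) (X (t + 1))) = 0"
      using prod_P_tplus_eq_0[of S T] \<open>S < T\<close> by auto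
  qed (use \<open>S < T\<close> in \<open>auto simp: paths_eq intro!: finite_PiE finite_configs\<close>)
  have "(\<Sum>X\<in>paths N T S. P_step N T S X Y * (\<Prod>t<T. P_tplus N T S t (X t) (X (t + 1))))
        * v 0 (packed_config N 0)
      = c * (\<Sum>X\<in>PiE {0..T} ?Q. v 0 (X 0) * (\<Prod>t<T. h t (X t) (X (t + 1))) * 1)"
    unfolding extend sum_distrib_left sum_distrib_right
    using eq X0 by (intro sum.cong refl) simp
  also have "(\<Sum>X\<in>PiE {0..T} ?Q. v 0 (X 0) * (\<Prod>t<T. h t (X t) (X (t + 1))) * 1)
      = (\<Sum>b\<in>?Q T. v T b * 1)"
  proof (rule sum_paths_intertwine[where g = "\<lambda>_. 1"])
    fix t b assume t: "t < T" and b: "b \<in> ?Q (t + 1)"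
    have "(\<Sum>a\<in>?Q t. v t a * h t a b)
        = v (t + 1) b * (matrix_prod (?Q t) (P_Sminus N T (S + 1) t) (P_tplus N T S t) (Y t) b
            / P_tplus_Sminus N T (S + 1) t (Y t) b)"
      by (simp add: matrix_prod_def h_def v_def sum_divide_distrib sum_distrib_left mult_ac)
    also have "\<dots> = v (t + 1) b * (P_tplus_Sminus N T (S + 1) t (Y t) b
            / P_tplus_Sminus N T (S + 1) t (Y t) b)"
      using P_tplus_Sminus_commute[OF D(1) b] t by simp
    also have "\<dots> = v (t + 1) b"
    \<comment> \<open>The quotient is 1 only if the denominator is nonzero; where it may vanish, the
      factor \<open>v (t + 1) b\<close> is 0.\<close>
    proof (cases "v (t + 1) b = 0")
      case False
      then have "0 < v (t + 1) b"
        using P_Sminus_nonneg[OF D(1)[of "t + 1"] b] t by (simp add: v_def)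
      then have "0 < P_tplus_Sminus N T (S + 1) t (Y t) b"
        using t b D(1)[of t] D(1)[of "t + 1"] D(4)[OF t]
        by (intro P_tplus_Sminus_pos[where y = "Y (t + 1)"]) (auto simp: v_def)
      then show ?thesis by simp
    qed simp
    finally show "(\<Sum>a\<in>?Q t. v t a * h t a b) = v (t + 1) b" .
  qed
  finally show ?thesis
    using D(2,3) \<open>S < T\<close> by (simp add: v_def c_def configs_final)
qed

theorem theorem3p1:
  fixes N T S :: nat
  assumes "N \<ge> 1" and "T \<ge> 1" and "S \<le> T - 1"
  shows "(\<forall>X\<in>paths N T S. \<forall>Y\<in>paths N T (S + 1). 0 \<le> P_step N T S X Y) \<and>
         (\<forall>X\<in>paths N T S. (\<Sum>Y\<in>paths N T (S + 1). P_step N T S X Y) = 1) \<and>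
         (\<forall>Y\<in>paths N T (S + 1).
            pmf (path_measure N T (S + 1)) Y
            = (\<Sum>X\<in>paths N T S. P_step N T S X Y * pmf (path_measure N T S) X))"
proof (intro conjI ballI)
  have ST: "S < T" "S \<le> T" "S + 1 \<le> T" using assms by auto
  show "0 \<le> P_step N T S X Y" if "X \<in> paths N T S" "Y \<in> paths N T (S + 1)" for X Y
    using that ST by (intro P_step_nonneg) (auto simp: paths_eq)
  show row: "(\<Sum>Y\<in>paths N T (S + 1). P_step N T S X Y) = 1" if "X \<in> paths N T S" for X
    by (rule P_step_row_sum[OF ST(1) that])
  fix Y assume Y: "Y \<in> paths N T (S + 1)"
  obtain X0 where X0: "X0 \<in> paths N T S" using paths_nonempty[OF ST(2)] by blast
  \<comment> \<open>The common weight of all families in \<open>paths N T S\<close>;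
    \<open>X0\<close> is an arbitrary representative.\<close>
  define c where "c = (\<Prod>t<T. P_tplus N T S t (X0 t) (X0 (t + 1)))"
  define d where "d = P_Sminus N T (S + 1) 0 (packed_config N 0) (packed_config N 0)"
  have pos: "0 < c" "0 < d"
    using pathsD(4)[OF X0 ST(2)] P_Sminus_initial_pos by (auto simp: c_def d_def intro!: prod_pos)
  define col where "col = (\<lambda>Y. \<Sum>X\<in>paths N T S. P_step N T S X Y)"
  have weighted: "col Y' * c * d = (\<Prod>t<T. P_tplus N T (S + 1) t (Y' t) (Y' (t + 1)))
      * P_Sminus N T (S + 1) T (packed_config N (S + 1)) (packed_config N S)"
    if "Y' \<in> paths N T (S + 1)" for Y'
    unfolding P_step_weighted_column_sum[OF ST(1) that, symmetric] col_def sum_distrib_right d_def c_def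
    by (intro sum.cong refl arg_cong2[where f = "(*)"] prod_P_tplus_path[OF X0 _ ST(2)])
  have const: "col Y' = col Y" if "Y' \<in> paths N T (S + 1)" for Y'
  proof -
    have "col Y' * c * d = col Y * c * d"
      unfolding weighted[OF that] weighted[OF Y] prod_P_tplus_path[OF that Y ST(3)] ..
    then show ?thesis using pos by simp
  qed
  \<comment> \<open>Summing all entries by rows and by columns determines the common column
    sum.\<close>
  have "real (card (paths N T S)) = (\<Sum>X\<in>paths N T S. \<Sum>Y\<in>paths N T (S + 1). P_step N T S X Y)"
    using row by simp
  also have "\<dots> = (\<Sum>Y\<in>paths N T (S + 1). col Y)"
    unfolding col_def by (rule sum.swap)
  also have "\<dots> = real (card (paths N T (S + 1))) * col Y"
    by (simp add: const)
  finally have "real (card (paths N T S)) = real (card (paths N T (S + 1))) * col Y" .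
  moreover have "card (paths N T S) > 0" "card (paths N T (S + 1)) > 0"
    using paths_nonempty finite_paths ST by (auto simp: card_gt_0_iff)
  ultimately have "1 / real (card (paths N T (S + 1))) = col Y / real (card (paths N T S))"
    by (auto simp: field_simps)
  then show "pmf (path_measure N T (S + 1)) Y
      = (\<Sum>X\<in>paths N T S. P_step N T S X Y * pmf (path_measure N T S) X)"
    using Y finite_paths paths_nonempty ST
    by (simp add: path_measure_def pmf_of_set col_def sum_divide_distrib)
qed

end
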